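(* Let $V$ be a real separable Hilbert space and let $a,b,m$ be symmetric bilinear forms on $V$ such that $a$ is continuous and $V$-coercive, $b$ is weakly continuous, and $m$ is weakly continuous with $m(u,u)>0$ for all nonzero $u\in V$. Then each variational eigencurve $\mu_n(\lambda)$ associated to $(a,b,m)$ is Lipschitz continuous.
   Context: "$a$ is continuous and $V$-coercive" means there are constants $0<\kappa_1\le\kappa_2<\infty$ with $\kappa_1\|u\|^2\le a(u,u)\le\kappa_2\|u\|^2$ for all $u\in V$. A symmetric bilinear form $b$ on $V$ is weakly continuous if $u_j\rightharpoonup u$ and $v_j\rightharpoonup v$ weakly in $V$ imply $b(u_j,v_j)\to b(u,v)$. For $\lambda\in\mathbb{R}$ and $n\in\mathbb{N}$ (with $n\le\dim V$ if $V$ is finite dimensional), $\mu_n(\lambda)$ is the $n$-th smallest, counted with multiplicity, of the real numbers $\mu$ for which there is a nonzero $u\in V$ with $a(u,v)-\lambda b(u,v)=\mu\,m(u,v)$ for all $v\in V$; equivalently $\mu_n(\lambda)=\inf_{Z_n}\sup_{0\ne v\in Z_n}\frac{a(v,v)-\lambda b(v,v)}{m(v,v)}$, the infimum being over all $n$-dimensional subspaces $Z_n$ of $V$. The graph of the function $\lambda\mapsto\mu_n(\lambda)$, $\lambda\in\mathbb{R}$, is the $n$-th variational eigencurve, and one also refers to $\mu_n(\lambda)$ itself as the $n$-th eigencurve.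
   Formalization: "Lipschitz continuous" is proved as Lipschitz on every bounded interval of λ; a global constant fails in general, e.g. on l² with a the inner product, b=diag(1/k), m=diag(1/k²), where μ_1(λ)=min_k(k²−λk) has unbounded slopes. *)

theory Defs
  imports "HOL-Analysis.Analysis"
begin

definition symmetric_bilinear_form :: "('a::real_vector \<Rightarrow> 'a \<Rightarrow> real) \<Rightarrow> bool" where
  "symmetric_bilinear_form f \<longleftrightarrow> bilinear f \<and> (\<forall>u v. f u v = f v u)"

definition continuous_coercive :: "('a::real_normed_vector \<Rightarrow> 'a \<Rightarrow> real) \<Rightarrow> bool" where
  "continuous_coercive a \<longleftrightarrow>
     (\<exists>\<kappa>\<^sub>1 \<kappa>\<^sub>2. 0 < \<kappa>\<^sub>1 \<and> \<kappa>\<^sub>1 \<le> \<kappa>\<^sub>2 \<and>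
        (\<forall>u. \<kappa>\<^sub>1 * (norm u)\<^sup>2 \<le> a u u \<and> a u u \<le> \<kappa>\<^sub>2 * (norm u)\<^sup>2))"

definition weakly_convergent_to :: "(nat \<Rightarrow> 'a::real_normed_vector) \<Rightarrow> 'a \<Rightarrow> bool" where
  "weakly_convergent_to x l \<longleftrightarrow>
     (\<forall>\<phi> :: 'a \<Rightarrow> real. bounded_linear \<phi> \<longrightarrow> (\<lambda>j. \<phi> (x j)) \<longlonglongrightarrow> \<phi> l)"

definition weakly_continuous_form :: "('a::real_normed_vector \<Rightarrow> 'a \<Rightarrow> real) \<Rightarrow> bool" where
  "weakly_continuous_form f \<longleftrightarrow>
     (\<forall>x y u v. weakly_convergent_to x u \<longrightarrow> weakly_convergent_to y v \<longrightarrow>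
        (\<lambda>j. f (x j) (y j)) \<longlonglongrightarrow> f u v)"

definition eigenspace ::
  "('a::real_vector \<Rightarrow> 'a \<Rightarrow> real) \<Rightarrow> ('a \<Rightarrow> 'a \<Rightarrow> real) \<Rightarrow> ('a \<Rightarrow> 'a \<Rightarrow> real)
     \<Rightarrow> real \<Rightarrow> real \<Rightarrow> 'a set" where
  "eigenspace a b m t \<mu> = {u. \<forall>v. a u v - t * b u v = \<mu> * m u v}"

definition eigenvalue ::
  "('a::real_vector \<Rightarrow> 'a \<Rightarrow> real) \<Rightarrow> ('a \<Rightarrow> 'a \<Rightarrow> real) \<Rightarrow> ('a \<Rightarrow> 'a \<Rightarrow> real)
     \<Rightarrow> real \<Rightarrow> real \<Rightarrow> bool" where
  "eigenvalue a b m t \<mu> \<longleftrightarrow> (\<exists>u. u \<noteq> 0 \<and> u \<in> eigenspace a b m t \<mu>)"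

text \<open>
  The n-th smallest eigenvalue counted with multiplicity is the least eigenvalue \<open>\<mu>\<close> such that
  the multiplicities of the eigenvalues up to \<open>\<mu>\<close> add up to at least \<open>n\<close> (the index starts at 1).
  The defaults (\<^term>\<open>dim\<close> of an infinite-dimensional space and a sum over an infinite set
  are 0) play no role for the forms considered here: if \<open>a\<close> is continuous and coercive, \<open>b\<close> and
  \<open>m\<close> are weakly continuous and \<open>m\<close> is positive definite, then every eigenspace is
  finite-dimensional and only finitely many eigenvalues lie below any given real number.
\<close>

definition eigencurve ::
  "('a::real_vector \<Rightarrow> 'a \<Rightarrow> real) \<Rightarrow> ('a \<Rightarrow> 'a \<Rightarrow> real) \<Rightarrow> ('a \<Rightarrow> 'a \<Rightarrow> real)
     \<Rightarrow> nat \<Rightarrow> real \<Rightarrow> real" where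
  "eigencurve a b m n t =
     (LEAST \<mu>. eigenvalue a b m t \<mu> \<and>
        n \<le> (\<Sum>\<nu> | eigenvalue a b m t \<nu> \<and> \<nu> \<le> \<mu>. dim (eigenspace a b m t \<nu>)))"

text \<open>
  Lipschitz continuity of a function on the whole real line is understood locally, that is, on
  every bounded interval. Eigencurves need not be globally Lipschitz: on the space of
  square-summable sequences let \<open>a\<close> be the inner product and let \<open>b\<close> and \<open>m\<close> be diagonal with
  entries \<open>1/k\<close> and \<open>1/k^2\<close>. The eigenvalues are then \<open>k^2 - t k\<close> for \<open>k \<ge> 1\<close>, so the first
  eigencurve is the minimum over \<open>k \<ge> 1\<close> of \<open>k^2 - t k\<close>, whose slopes are unbounded.
\<close>

definition locally_lipschitz :: "(real \<Rightarrow> real) \<Rightarrow> bool" where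
  "locally_lipschitz f \<longleftrightarrow> (\<forall>\<alpha> \<beta>. \<exists>L. L-lipschitz_on {\<alpha>..\<beta>} f)"

end

theory Submission
  imports Defs "HOL-Complex_Analysis.Great_Picard"
begin

text \<open>
  Fix a bounded interval of parameters and write \<open>c t\<close> for the form \<open>a - t b\<close>. The proof compares
  the quadratic forms at two parameters and passes to eigenvalues by the min-max principle.

  Weak compactness of bounded sets yields, for every \<open>\<epsilon> > 0\<close>, a bound
  \<open>\<bar>b u u\<bar> \<le> \<epsilon> a u u + C m u u\<close> (\<open>relative_form_bound\<close>). With a small \<open>\<epsilon>\<close> the term \<open>t b\<close> is absorbed
  by \<open>a\<close>, uniformly on the interval. This has two consequences. Each \<open>c t\<close> is coercive up to a
  multiple of \<open>m\<close>, and \<open>\<bar>b u u\<bar> \<le> A (c t u u) + B m u u\<close> with constants \<open>A \<ge> 0\<close> and \<open>B\<close> that depend only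
  on the interval. Hence
  \<open>c s u u \<le> (1 + A \<bar>s - t\<bar>) (c t u u) + B \<bar>s - t\<bar> m u u\<close>, and monotonicity of the \<open>n\<close>-th eigenvalue
  (\<open>nth_eigenvalue_comparison\<close>) gives \<open>\<mu> s - \<mu> t \<le> \<bar>s - t\<bar> (A (\<mu> t) + B)\<close>. With \<open>t\<close> the left end
  point this bounds \<open>\<mu>\<close> from above on the interval, and then the same inequality is a Lipschitz
  estimate.

  Monotonicity requires the variational description of eigenvalues that are defined by counting
  multiplicities. Two facts suffice. There are only finitely many eigenvalues up to \<open>\<tau>\<close>, counted
  with multiplicity, and they come with an orthonormal set of eigenvectors that spans the
  corresponding eigenspaces (\<open>complete_orthonormal_eigenvectors\<close>). Their number is at least the
  dimension of any subspace on which the Rayleigh quotient is at most \<open>\<tau>\<close>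
  (\<open>card_le_multiplicity_upto\<close>). The latter rests on the minimisation of the Rayleigh quotient on an
  orthogonal complement, the only place where eigenvectors are produced
  (\<open>constrained_minimiser_eigenvector\<close>).
\<close>

section \<open>Weak sequential compactness in separable Hilbert spaces\<close>

text \<open>
  The first-order condition at a minimum: it is used for the Riesz functional and for the
  constrained Rayleigh quotient.
\<close>

lemma linear_term_zero_if_quadratic_nonneg:
  fixes p q :: real
  assumes "\<And>t. 0 \<le> 2 * t * p + t\<^sup>2 * q"
  shows "p = 0"
proof (rule ccontr)
  assume "p \<noteq> 0"
  \<comment> \<open>For \<open>d > q\<close> the choice \<open>t = - p / d\<close> gives the value \<open>p\<^sup>2 (q - 2 d) / d\<^sup>2\<close>, which is negative.\<close>
  define d where "d = \<bar>q\<bar> + 1"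
  have d: "d > 0" "q < d" by (auto simp: d_def)
  have "2 * (- (p / d)) * p + (- (p / d))\<^sup>2 * q = (p\<^sup>2 / d\<^sup>2) * (q - 2 * d)"
    using d by (simp add: power2_eq_square field_simps)
  moreover have "(p\<^sup>2 / d\<^sup>2) * (q - 2 * d) < 0"
    using \<open>p \<noteq> 0\<close> d by (intro mult_pos_neg) auto
  ultimately show False using assms[of "- (p / d)"] by linarith
qed

text \<open>
  The representing vector minimises \<open>\<parallel>u\<parallel>\<^sup>2 - 2 \<phi>(u)\<close>. By the parallelogram law every minimising
  sequence is Cauchy, and the first-order condition at its limit is the representation.
\<close>

lemma riesz_representation:
  fixes \<phi> :: "'a::{real_inner, complete_space} \<Rightarrow> real"
  assumes "bounded_linear \<phi>"
  obtains w where "\<And>v. \<phi> v = w \<bullet> v"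
proof -
  interpret bounded_linear \<phi> by fact
  define J where "J u = (norm u)\<^sup>2 - 2 * \<phi> u" for u
  obtain C where C: "\<And>u. \<bar>\<phi> u\<bar> \<le> norm u * C" using bounded by auto
  have J_bound: "J u \<ge> - C\<^sup>2" for u
  proof -
    have "0 \<le> (norm u - C)\<^sup>2" by simp
    also have "\<dots> = (norm u)\<^sup>2 - 2 * (norm u * C) + C\<^sup>2" by (simp add: power2_diff)
    finally show ?thesis using C[of u] unfolding J_def by linarith
  qed
  define d where "d = (INF u. J u)"
  have bdd: "bdd_below (range J)" using J_bound by (rule bdd_belowI2)
  have d_le: "d \<le> J u" for u unfolding d_def using bdd by (rule cINF_lower) simp
  have "\<exists>u. J u < d + 1 / real (Suc j)" for j
  proof (rule ccontr)
    assume "\<not> ?thesis"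
    then have "d + 1 / real (Suc j) \<le> d"
      unfolding d_def by (intro cINF_greatest) (auto simp: not_less)
    then show False by simp
  qed
  then obtain u where u: "\<And>j. J (u j) < d + 1 / real (Suc j)" by metis
  have near: "(norm (u i - u j))\<^sup>2 < 2 / real (Suc i) + 2 / real (Suc j)" for i j
  proof -
    have "(norm (u i - u j))\<^sup>2 = 2 * J (u i) + 2 * J (u j) - 4 * J ((1/2) *\<^sub>R (u i + u j))"
      unfolding J_def power2_norm_eq_inner by (simp add: scale add inner_simps inner_commute field_simps)
    also have "\<dots> \<le> 2 * J (u i) + 2 * J (u j) - 4 * d" using d_le by simp
    also have "\<dots> < 2 / real (Suc i) + 2 / real (Suc j)" using u[of i] u[of j] by linarith
    finally show ?thesis .
  qed
  have "Cauchy u"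
  proof (rule metric_CauchyI)
    fix e :: real assume "e > 0"
    obtain N where "4 / e\<^sup>2 < real N" using reals_Archimedean2 by blast
    then have N: "4 / e\<^sup>2 < real (Suc N)" by simp
    have "dist (u i) (u j) < e" if "i \<ge> N" "j \<ge> N" for i j
    proof -
      have "2 / real (Suc i) + 2 / real (Suc j) \<le> 2 / real (Suc N) + 2 / real (Suc N)"
        using that by (intro add_mono divide_left_mono) auto
      also have "\<dots> = 4 / real (Suc N)" by simp
      also have "\<dots> < e\<^sup>2" using N \<open>e > 0\<close> by (simp add: field_simps)
      finally have "(norm (u i - u j))\<^sup>2 < e\<^sup>2" using near[of i j] by simp
      then show ?thesis using \<open>e > 0\<close> by (simp add: dist_norm power2_less_imp_less)
    qed
    then show "\<exists>M. \<forall>i\<ge>M. \<forall>j\<ge>M. dist (u i) (u j) < e" by blast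
  qed
  then obtain w where w: "u \<longlonglongrightarrow> w" using Cauchy_convergent convergent_def by blast
  have "(\<lambda>j. J (u j)) \<longlonglongrightarrow> J w"
    unfolding J_def by (intro tendsto_diff tendsto_power tendsto_norm tendsto_mult tendsto_const tendsto w)
  moreover have "(\<lambda>j. d + 1 / real (Suc j)) \<longlonglongrightarrow> d + 0"
    by (intro tendsto_add tendsto_const LIMSEQ_Suc[OF lim_1_over_n])
  ultimately have "J w \<le> d + 0"
    by (rule LIMSEQ_le) (use u less_imp_le in blast)
  then have min: "J w \<le> J v" for v using d_le[of v] by simp
  have "w \<bullet> v - \<phi> v = 0" for v
  proof (rule linear_term_zero_if_quadratic_nonneg)
    fix t :: real
    have "J (w + t *\<^sub>R v) - J w = 2 * t * (w \<bullet> v - \<phi> v) + t\<^sup>2 * (v \<bullet> v)"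
      unfolding J_def power2_norm_eq_inner
      by (simp add: scale add inner_simps inner_commute algebra_simps power2_eq_square)
    then show "0 \<le> 2 * t * (w \<bullet> v - \<phi> v) + t\<^sup>2 * (v \<bullet> v)" using min[of "w + t *\<^sub>R v"] by simp
  qed
  then show ?thesis using that[of w] by simp
qed

text \<open>
  A diagonal argument makes the inner products with a countable dense set converge along one
  subsequence; boundedness extends this to all vectors. The limits form a bounded functional, and
  its Riesz vector is the weak limit. A second use of the Riesz representation lets inner products
  stand for arbitrary bounded functionals.
\<close>

lemma bounded_imp_weakly_convergent_subsequence:
  fixes x :: "nat \<Rightarrow> 'a::{real_inner, complete_space}"
  assumes sep: "separable_space (euclidean :: 'a topology)"
    and R: "\<And>j. norm (x j) \<le> R"
  obtains u r where "strict_mono (r :: nat \<Rightarrow> nat)" "weakly_convergent_to (x \<circ> r) u"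
proof -
  obtain D :: "'a set" where D: "countable D" "closure D = UNIV"
    using sep unfolding separable_space_def by auto
  \<comment> \<open>The unit vectors provide one bound for the whole dense set, as the diagonal extraction requires.\<close>
  have "norm (x j \<bullet> sgn d) \<le> R" for j d
  proof -
    have "norm (x j \<bullet> sgn d) \<le> norm (x j) * norm (sgn d)" by (simp add: Cauchy_Schwarz_ineq2)
    also have "\<dots> \<le> norm (x j) * 1" by (intro mult_left_mono) (auto simp: norm_sgn)
    finally show ?thesis using R[of j] by simp
  qed
  then obtain r where r: "strict_mono (r :: nat \<Rightarrow> nat)"
    and rD: "\<And>d. d \<in> D \<Longrightarrow> \<exists>l. (\<lambda>j. x (r j) \<bullet> sgn d) \<longlonglongrightarrow> l"
    using function_convergent_subsequence[OF D(1), of "\<lambda>j d. x j \<bullet> sgn d" R] by blast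
  have conv_D: "convergent (\<lambda>j. x (r j) \<bullet> d)" if d: "d \<in> D" for d
  proof -
    obtain l where "(\<lambda>j. x (r j) \<bullet> sgn d) \<longlonglongrightarrow> l" using rD[OF d] by blast
    then have "(\<lambda>j. norm d * (x (r j) \<bullet> sgn d)) \<longlonglongrightarrow> norm d * l" by (intro tendsto_mult tendsto_const)
    moreover have "norm d * (x (r j) \<bullet> sgn d) = x (r j) \<bullet> d" for j
      by (cases "d = 0") (auto simp: sgn_div_norm)
    ultimately show ?thesis by (auto simp: convergent_def)
  qed
  have R0: "R \<ge> 0" using R[of 0] norm_ge_zero order_trans by blast
  have "Cauchy (\<lambda>j. x (r j) \<bullet> v)" for v
  proof (rule metric_CauchyI)
    fix e :: real assume e: "e > 0"
    define \<delta> where "\<delta> = e / (3 * (R + 1))"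
    have \<delta>: "\<delta> > 0" "R * \<delta> < e / 3" using e R0 by (auto simp: \<delta>_def field_simps)
    have "v \<in> closure D" using D by simp
    then obtain d where d: "d \<in> D" "dist d v < \<delta>" using closure_approachable \<delta>(1) by blast
    have "Cauchy (\<lambda>j. x (r j) \<bullet> d)" using conv_D[OF d(1)] by (simp add: Cauchy_convergent_iff)
    then obtain M where M: "\<And>i j. i \<ge> M \<Longrightarrow> j \<ge> M \<Longrightarrow> dist (x (r i) \<bullet> d) (x (r j) \<bullet> d) < e / 3"
      using metric_CauchyD[of "\<lambda>j. x (r j) \<bullet> d" "e / 3"] e by auto
    have near: "\<bar>x (r j) \<bullet> v - x (r j) \<bullet> d\<bar> < e / 3" for j
    proof -
      have "\<bar>x (r j) \<bullet> v - x (r j) \<bullet> d\<bar> = \<bar>x (r j) \<bullet> (v - d)\<bar>" by (simp add: inner_diff_right)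
      also have "\<dots> \<le> norm (x (r j)) * norm (v - d)" by (rule Cauchy_Schwarz_ineq2)
      also have "\<dots> \<le> R * \<delta>"
        using d(2) R R0 by (intro mult_mono) (auto simp: dist_norm norm_minus_commute)
      finally show ?thesis using \<delta>(2) by simp
    qed
    have "dist (x (r i) \<bullet> v) (x (r j) \<bullet> v) < e" if "i \<ge> M" "j \<ge> M" for i j
      using M[OF that] near[of i] near[of j] unfolding dist_real_def by linarith
    then show "\<exists>M. \<forall>i\<ge>M. \<forall>j\<ge>M. dist (x (r i) \<bullet> v) (x (r j) \<bullet> v) < e" by blast
  qed
  then have lim: "(\<lambda>j. x (r j) \<bullet> v) \<longlonglongrightarrow> lim (\<lambda>j. x (r j) \<bullet> v)" for v
    using Cauchy_convergent convergent_LIMSEQ_iff by blast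
  define l where "l v = lim (\<lambda>j. x (r j) \<bullet> v)" for v
  have l: "(\<lambda>j. x (r j) \<bullet> v) \<longlonglongrightarrow> l v" for v using lim by (simp add: l_def)
  have "bounded_linear l"
  proof (rule bounded_linear_intro)
    fix v w :: 'a and k :: real
    have "(\<lambda>j. x (r j) \<bullet> (v + w)) \<longlonglongrightarrow> l v + l w"
      unfolding inner_add_right by (intro tendsto_add l)
    then show "l (v + w) = l v + l w" using l LIMSEQ_unique by blast
    have "(\<lambda>j. x (r j) \<bullet> (k *\<^sub>R v)) \<longlonglongrightarrow> k *\<^sub>R l v"
      unfolding inner_scaleR_right real_scaleR_def by (intro tendsto_mult_left l)
    then show "l (k *\<^sub>R v) = k *\<^sub>R l v" using l LIMSEQ_unique by blast
    have "norm (x (r j) \<bullet> v) \<le> norm v * R" for j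
    proof -
      have "norm (x (r j) \<bullet> v) \<le> norm (x (r j)) * norm v" by (simp add: Cauchy_Schwarz_ineq2)
      also have "\<dots> \<le> R * norm v" by (intro mult_right_mono R) auto
      finally show ?thesis by (simp add: mult.commute)
    qed
    then show "norm (l v) \<le> norm v * R"
      using LIMSEQ_le_const2[OF tendsto_norm[OF l[of v]]] by blast
  qed
  then obtain u where u: "\<And>v. l v = u \<bullet> v" using riesz_representation by blast
  have "weakly_convergent_to (x \<circ> r) u"
    unfolding weakly_convergent_to_def
  proof (intro allI impI)
    fix \<phi> :: "'a \<Rightarrow> real" assume "bounded_linear \<phi>"
    then obtain w where w: "\<And>v. \<phi> v = w \<bullet> v" using riesz_representation by blast
    show "(\<lambda>j. \<phi> ((x \<circ> r) j)) \<longlonglongrightarrow> \<phi> u"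
      using l[of w] by (simp add: w u inner_commute)
  qed
  with r show ?thesis by (rule that)
qed

lemma weakly_convergent_subsequence:
  assumes "weakly_convergent_to x u" "strict_mono (r :: nat \<Rightarrow> nat)"
  shows "weakly_convergent_to (x \<circ> r) u"
  unfolding weakly_convergent_to_def
proof (intro allI impI)
  fix \<phi> :: "'a \<Rightarrow> real" assume "bounded_linear \<phi>"
  then have "(\<lambda>j. \<phi> (x j)) \<longlonglongrightarrow> \<phi> u" using assms(1) by (auto simp: weakly_convergent_to_def)
  from LIMSEQ_subseq_LIMSEQ[OF this assms(2)] show "(\<lambda>j. \<phi> ((x \<circ> r) j)) \<longlonglongrightarrow> \<phi> u"
    by (simp add: o_def)
qed

lemma weakly_convergent_const: "weakly_convergent_to (\<lambda>_. u) u"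
  by (simp add: weakly_convergent_to_def)

section \<open>Orthonormal sets for a symmetric bilinear form\<close>

definition orthonormal_for :: "('a::real_vector \<Rightarrow> 'a \<Rightarrow> real) \<Rightarrow> 'a set \<Rightarrow> bool" where
  "orthonormal_for m S \<longleftrightarrow> (\<forall>e\<in>S. m e e = 1) \<and> (\<forall>e\<in>S. \<forall>f\<in>S. e \<noteq> f \<longrightarrow> m e f = 0)"

locale symmetric_form =
  fixes f :: "'a::real_vector \<Rightarrow> 'a \<Rightarrow> real"
  assumes form: "symmetric_bilinear_form f"
begin

lemma bil: "bilinear f" and sym: "f u v = f v u"
  using form by (auto simp: symmetric_bilinear_form_def)

lemmas rules =
  bilinear_ladd[OF bil] bilinear_radd[OF bil] bilinear_lsub[OF bil] bilinear_rsub[OF bil]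
  bilinear_lmul[OF bil] bilinear_rmul[OF bil] bilinear_lzero[OF bil] bilinear_rzero[OF bil]

lemma sum_left: "f (\<Sum>i\<in>I. g i) v = (\<Sum>i\<in>I. f (g i) v)"
  using linear_sum[of "\<lambda>u. f u v" g I] bil by (simp add: bilinear_def)

lemma sum_right: "f v (\<Sum>i\<in>I. g i) = (\<Sum>i\<in>I. f v (g i))"
  using sum_left[of g I v] unfolding sym[of v] .

lemma diff_diff: "f (u - v) (u - v) = f u u - 2 * f u v + f v v"
  by (simp add: rules sym[of v u])

lemma orthogonal_span:
  assumes "w \<in> span S" "\<And>e. e \<in> S \<Longrightarrow> f u e = 0"
  shows "f u w = 0"
proof -
  have "span S \<subseteq> {w. f u w = 0}"
    using assms(2) by (intro span_minimal) (auto simp: rules subspace_def)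
  then show ?thesis using assms(1) by blast
qed

lemma orthonormal_sum_coefficient:
  assumes "finite S" "orthonormal_for f S" "e \<in> S"
  shows "f (\<Sum>s\<in>S. x s *\<^sub>R s) e = x e"
proof -
  have "f (\<Sum>s\<in>S. x s *\<^sub>R s) e = (\<Sum>s\<in>S. if s = e then x e else 0)"
    unfolding sum_left using assms by (intro sum.cong) (auto simp: rules orthonormal_for_def)
  then show ?thesis using assms by simp
qed

lemma orthonormal_sum_square:
  assumes "finite S" "orthonormal_for f S"
  shows "f (\<Sum>s\<in>S. x s *\<^sub>R s) (\<Sum>s\<in>S. x s *\<^sub>R s) = (\<Sum>s\<in>S. (x s)\<^sup>2)"
  unfolding sum_right[of _ _ S]
  by (intro sum.cong refl) (simp add: rules orthonormal_sum_coefficient[OF assms] power2_eq_square)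

lemma orthonormal_residual:
  assumes "finite S" "orthonormal_for f S" "e \<in> S"
  shows "f (v - (\<Sum>s\<in>S. f v s *\<^sub>R s)) e = 0"
  using orthonormal_sum_coefficient[OF assms, of "f v"] by (simp add: rules)

lemma orthonormal_independent:
  assumes "finite S" "orthonormal_for f S"
  shows "independent S"
proof
  assume "dependent S"
  then obtain x e where x: "e \<in> S" "x e \<noteq> 0" "(\<Sum>s\<in>S. x s *\<^sub>R s) = 0"
    using dependent_finite[OF assms(1)] by auto
  have "x e = f 0 e" using orthonormal_sum_coefficient[OF assms x(1), of x] x(3) by simp
  then show False using x(2) by (simp add: rules)
qed

text \<open>
  The projection of \<open>span P\<close> to \<open>span S\<close> along \<open>f\<close> cannot be injective, because the target has the
  smaller dimension. This dimension count is what turns subspaces into lower bounds for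
  multiplicities.
\<close>

lemma exists_orthogonal_in_larger_span:
  assumes S: "finite S" "orthonormal_for f S"
    and P: "finite P" "independent P" "card S < card P"
  obtains z where "z \<in> span P" "z \<noteq> 0" "\<And>e. e \<in> S \<Longrightarrow> f z e = 0"
proof -
  define p where "p v = (\<Sum>s\<in>S. f v s *\<^sub>R s)" for v
  have lin: "linear p"
    by (rule linearI)
      (simp_all add: p_def rules scaleR_add_left sum.distrib scaleR_right.sum)
  have "\<not> inj_on p (span P)"
  proof
    assume "inj_on p (span P)"
    then have "independent (p ` P)" "card (p ` P) = card P"
      using linear_independent_injective_image[OF lin P(2)]
        card_image[OF inj_on_subset[OF _ span_superset]] by auto
    moreover have "p ` P \<subseteq> span S"
      unfolding p_def by (auto intro: span_sum span_scale span_base)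
    ultimately show False using independent_span_bound[OF S(1), of "p ` P"] P(3) by auto
  qed
  then obtain z where z: "z \<in> span P" "p z = 0" "z \<noteq> 0"
    using linear_injective_on_subspace_0[OF lin subspace_span, of P] by auto
  have "f z e = 0" if "e \<in> S" for e
    using orthonormal_residual[OF S that, of z] z(2) by (simp add: p_def)
  with z show ?thesis using that by blast
qed

end

section \<open>The eigenvalue problem of a pair of forms\<close>

definition pencil_eigenspace ::
  "('a::real_vector \<Rightarrow> 'a \<Rightarrow> real) \<Rightarrow> ('a \<Rightarrow> 'a \<Rightarrow> real) \<Rightarrow> real \<Rightarrow> 'a set" where
  "pencil_eigenspace c m \<mu> = {u. \<forall>v. c u v = \<mu> * m u v}"

text \<open>
  In the application \<open>c\<close> is \<open>a - t b\<close> for a fixed \<open>t\<close>. This form need not be coercive, but it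
  becomes so after adding a multiple of \<open>m\<close>, which only shifts the eigenvalues; the shift is kept
  explicit as the constant \<open>K\<close> of a Garding inequality.
\<close>

locale form_pencil = c: symmetric_form c + m: symmetric_form m
  for c m :: "'a::{real_inner, complete_space} \<Rightarrow> 'a \<Rightarrow> real" +
  fixes \<kappa> K :: real
  assumes separable: "separable_space (euclidean :: 'a topology)"
    and m_weak: "weakly_continuous_form m"
    and m_pos: "u \<noteq> 0 \<Longrightarrow> m u u > 0"
    and \<kappa>_pos: "\<kappa> > 0"
    and garding: "\<kappa> * (norm u)\<^sup>2 \<le> c u u + K * m u u"
    and c_weak: "weakly_convergent_to x u \<Longrightarrow> (\<lambda>j. c (x j) v) \<longlonglongrightarrow> c u v"
begin

abbreviation E where "E \<equiv> pencil_eigenspace c m"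

definition spectrum_upto :: "real \<Rightarrow> real set" where
  "spectrum_upto \<tau> = {\<nu>. (\<exists>u. u \<noteq> 0 \<and> u \<in> E \<nu>) \<and> \<nu> \<le> \<tau>}"

definition multiplicity_upto :: "real \<Rightarrow> nat" where
  "multiplicity_upto \<tau> = (\<Sum>\<nu>\<in>spectrum_upto \<tau>. dim (E \<nu>))"

lemma eigenD: "u \<in> E \<mu> \<Longrightarrow> c u v = \<mu> * m u v"
  by (simp add: pencil_eigenspace_def)

lemma subspace_E: "subspace (E \<mu>)"
  by (auto simp: subspace_def pencil_eigenspace_def c.rules m.rules algebra_simps)

lemma eigen_orthogonal:
  assumes "u \<in> E \<mu>" "v \<in> E \<nu>" "\<mu> \<noteq> \<nu>"
  shows "m u v = 0"
  using eigenD[OF assms(1), of v] eigenD[OF assms(2), of u] assms(3) c.sym[of v u] m.sym[of v u]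
  by simp

lemma m_weakD:
  "weakly_convergent_to x u \<Longrightarrow> weakly_convergent_to y v \<Longrightarrow> (\<lambda>j. m (x j) (y j)) \<longlonglongrightarrow> m u v"
  using m_weak by (auto simp: weakly_continuous_form_def)

lemma normalise:
  assumes "z \<noteq> 0"
  obtains k where "k \<noteq> 0" "m (k *\<^sub>R z) (k *\<^sub>R z) = 1" "c (k *\<^sub>R z) (k *\<^sub>R z) = c z z / m z z"
proof
  have pos: "m z z > 0" using assms by (rule m_pos)
  let ?k = "1 / sqrt (m z z)"
  show "?k \<noteq> 0" using pos by simp
  show "m (?k *\<^sub>R z) (?k *\<^sub>R z) = 1" "c (?k *\<^sub>R z) (?k *\<^sub>R z) = c z z / m z z"
    using pos by (simp_all add: m.rules c.rules field_simps)
qed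

text \<open>
  The Garding inequality turns a bound on the energy \<open>c\<close> under the normalisation by \<open>m\<close> into a bound
  on the norm.
\<close>

lemma bounded_energy_weak_subsequence:
  assumes "\<And>j. m (w j) (w j) = 1" "\<And>j. c (w j) (w j) \<le> T"
  obtains u r where "strict_mono (r :: nat \<Rightarrow> nat)" "weakly_convergent_to (w \<circ> r) u"
proof -
  have "norm (w j) \<le> sqrt ((T + K) / \<kappa>)" for j
  proof (rule real_le_rsqrt)
    show "(norm (w j))\<^sup>2 \<le> (T + K) / \<kappa>"
      using garding[of "w j"] assms[of j] \<kappa>_pos by (simp add: field_simps)
  qed
  from bounded_imp_weakly_convergent_subsequence[OF separable, of w, OF this] that
  show ?thesis .
qed

text \<open>
  An infinite orthonormal set of bounded energy would contain a sequence \<open>w\<close> of distinct vectors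
  with a weak limit \<open>u\<close>. Weak continuity of \<open>m\<close>, applied to the sequence with itself and with its own
  shift by one, gives both \<open>m u u = 1\<close> and \<open>m u u = 0\<close>. Discreteness of the spectrum and finiteness of
  the multiplicities both come from here.
\<close>

lemma orthonormal_bounded_energy_finite:
  assumes "orthonormal_for m S" "\<And>e. e \<in> S \<Longrightarrow> c e e \<le> T"
  shows "finite S"
proof (rule ccontr)
  assume "infinite S"
  then obtain w :: "nat \<Rightarrow> 'a" where w: "inj w" "range w \<subseteq> S"
    using infinite_countable_subset by blast
  have wS: "w j \<in> S" for j using w(2) by blast
  have one: "m (w j) (w j) = 1" for j using assms(1) wS by (simp add: orthonormal_for_def)
  have zero: "m (w i) (w j) = 0" if "i \<noteq> j" for i j
    using assms(1) wS w(1) that by (simp add: orthonormal_for_def inj_eq)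
  obtain u r where r: "strict_mono (r :: nat \<Rightarrow> nat)" and u: "weakly_convergent_to (w \<circ> r) u"
    using bounded_energy_weak_subsequence[of w T, OF one assms(2)[OF wS]] .
  have "strict_mono Suc" by (simp add: strict_mono_Suc_iff)
  from weakly_convergent_subsequence[OF u this]
  have u': "weakly_convergent_to (w \<circ> r \<circ> Suc) u" .
  have "(\<lambda>j. m ((w \<circ> r) j) ((w \<circ> r) j)) \<longlonglongrightarrow> m u u" by (rule m_weakD[OF u u])
  then have "m u u = 1" by (simp add: one LIMSEQ_const_iff)
  moreover have "(\<lambda>j. m ((w \<circ> r) j) ((w \<circ> r \<circ> Suc) j)) \<longlonglongrightarrow> m u u" by (rule m_weakD[OF u u'])
  moreover have "m ((w \<circ> r) j) ((w \<circ> r \<circ> Suc) j) = 0" for j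
    using strict_mono_eq[OF r, of j "Suc j"] by (simp add: zero)
  ultimately show False by (simp add: LIMSEQ_const_iff)
qed

text \<open>
  The Rayleigh quotient \<open>c / m\<close> attains its minimum \<open>\<mu>\<close> on the \<open>m\<close>-orthogonal complement \<open>W\<close> of \<open>S\<close>,
  by weak compactness: \<open>W\<close> and the constraint \<open>m u u = 1\<close> pass to weak limits, and \<open>c\<close> is weakly
  lower semicontinuous up to a multiple of \<open>m\<close>. A minimiser satisfies the eigenvalue equation
  against test vectors in \<open>W\<close>. Against \<open>S\<close> both sides vanish because the elements of \<open>S\<close> are
  eigenvectors, so that \<open>u\<close> is an eigenvector on the whole space.
\<close>

lemma constrained_minimiser_eigenvector:
  assumes S: "finite S" "orthonormal_for m S" "\<And>e. e \<in> S \<Longrightarrow> \<exists>\<nu>. e \<in> E \<nu>"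
    and z: "z \<noteq> 0" "\<And>e. e \<in> S \<Longrightarrow> m z e = 0"
  obtains u \<mu> where "u \<in> E \<mu>" "m u u = 1" "\<forall>e\<in>S. m u e = 0" "\<mu> * m z z \<le> c z z"
proof -
  define W where "W = {w. \<forall>e\<in>S. m w e = 0}"
  define A where "A = {c w w | w. w \<in> W \<and> m w w = 1}"
  define \<mu> where "\<mu> = Inf A"
  have W_scale: "k *\<^sub>R w \<in> W" if "w \<in> W" for k w using that by (simp add: W_def m.rules)
  have W_add: "w + w' \<in> W" if "w \<in> W" "w' \<in> W" for w w' using that by (simp add: W_def m.rules)
  have "- K \<le> x" if "x \<in> A" for x
  proof -
    obtain w where w: "x = c w w" "m w w = 1" using \<open>x \<in> A\<close> by (auto simp: A_def)
    have "0 \<le> \<kappa> * (norm w)\<^sup>2" using \<kappa>_pos by simp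
    then show ?thesis using garding[of w] w by simp
  qed
  then have bdd: "bdd_below A" by (rule bdd_belowI)
  have quotient_in_A: "c w w / m w w \<in> A" if "w \<in> W" "w \<noteq> 0" for w
  proof -
    obtain k where "m (k *\<^sub>R w) (k *\<^sub>R w) = 1" "c (k *\<^sub>R w) (k *\<^sub>R w) = c w w / m w w"
      using normalise[OF \<open>w \<noteq> 0\<close>] by blast
    then show ?thesis unfolding A_def using W_scale[OF \<open>w \<in> W\<close>, of k] by force
  qed
  have mu_le: "\<mu> * m w w \<le> c w w" if "w \<in> W" for w
  proof (cases "w = 0")
    case False
    then have "\<mu> \<le> c w w / m w w"
      unfolding \<mu>_def using quotient_in_A[OF that] bdd by (intro cInf_lower) auto
    then show ?thesis using m_pos[OF False] by (simp add: pos_le_divide_eq)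
  qed (simp add: m.rules c.rules)
  have zW: "z \<in> W" using z(2) by (simp add: W_def)
  then have "A \<noteq> {}" using quotient_in_A z(1) by blast
  then have "\<exists>x\<in>A. x < \<mu> + 1 / real (Suc j)" for j
    by (rule cInf_lessD) (simp add: \<mu>_def)
  then have "\<exists>w. w \<in> W \<and> m w w = 1 \<and> c w w < \<mu> + 1 / real (Suc j)" for j
    unfolding A_def by blast
  then obtain w where w: "\<And>j. w j \<in> W" "\<And>j. m (w j) (w j) = 1"
    "\<And>j. c (w j) (w j) < \<mu> + 1 / real (Suc j)" by metis
  have w_bound: "c (w j) (w j) \<le> \<mu> + 1" for j
  proof -
    have "1 / real (Suc j) \<le> 1" by simp
    then show ?thesis using w(3)[of j] by linarith
  qed
  obtain u r where r: "strict_mono (r :: nat \<Rightarrow> nat)" and u: "weakly_convergent_to (w \<circ> r) u"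
    using bounded_energy_weak_subsequence[of w, OF w(2) w_bound] .
  have "(\<lambda>j. m ((w \<circ> r) j) ((w \<circ> r) j)) \<longlonglongrightarrow> m u u" by (rule m_weakD[OF u u])
  then have u_one: "m u u = 1" by (simp add: w(2) LIMSEQ_const_iff)
  have lim_m: "(\<lambda>j. m ((w \<circ> r) j) v) \<longlonglongrightarrow> m u v" for v
    by (rule m_weakD[OF u weakly_convergent_const])
  have uW: "u \<in> W"
  proof -
    have "m u e = 0" if "e \<in> S" for e
      using lim_m[of e] w(1) that by (simp add: W_def LIMSEQ_const_iff)
    then show ?thesis by (simp add: W_def)
  qed
  have "c u u \<le> \<mu>"
  proof -
    \<comment> \<open>Lower semicontinuity: expand the Garding inequality for \<open>w - u\<close>. The bound is linear in \<open>w\<close>,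
      and the factor of \<open>K\<close> tends to 0 because \<open>m u u = 1\<close>.\<close>
    have lower: "2 * c ((w \<circ> r) j) u - c u u - K * (1 - 2 * m ((w \<circ> r) j) u + m u u)
        \<le> \<mu> + 1 / real (Suc (r j))" for j
    proof -
      let ?w = "w (r j)"
      have "0 \<le> \<kappa> * (norm (?w - u))\<^sup>2" using \<kappa>_pos by simp
      also have "\<dots> \<le> c (?w - u) (?w - u) + K * m (?w - u) (?w - u)" by (rule garding)
      also have "\<dots> = c ?w ?w - 2 * c ?w u + c u u + K * (1 - 2 * m ?w u + m u u)"
        by (simp add: c.diff_diff m.diff_diff w(2))
      finally show ?thesis using w(3)[of "r j"] by simp
    qed
    have "(\<lambda>j. 2 * c ((w \<circ> r) j) u - c u u - K * (1 - 2 * m ((w \<circ> r) j) u + m u u))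
        \<longlonglongrightarrow> 2 * c u u - c u u - K * (1 - 2 * m u u + m u u)"
      by (intro tendsto_diff tendsto_add tendsto_mult tendsto_const c_weak[OF u] lim_m)
    moreover have "(\<lambda>j. \<mu> + 1 / real (Suc (r j))) \<longlonglongrightarrow> \<mu> + 0"
      using LIMSEQ_subseq_LIMSEQ[OF LIMSEQ_Suc[OF lim_1_over_n] r]
      by (intro tendsto_add tendsto_const) (simp add: o_def)
    ultimately have "2 * c u u - c u u - K * (1 - 2 * m u u + m u u) \<le> \<mu> + 0"
      by (rule LIMSEQ_le) (use lower in blast)
    then show ?thesis by (simp add: u_one)
  qed
  then have cu: "c u u = \<mu>" using mu_le[OF uW] u_one by simp
  have eigen_W: "c u v - \<mu> * m u v = 0" if "v \<in> W" for v
  proof (rule linear_term_zero_if_quadratic_nonneg)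
    fix t :: real
    have "\<mu> * m (u + t *\<^sub>R v) (u + t *\<^sub>R v) \<le> c (u + t *\<^sub>R v) (u + t *\<^sub>R v)"
      using W_add[OF uW W_scale[OF that]] by (rule mu_le)
    then show "0 \<le> 2 * t * (c u v - \<mu> * m u v) + t\<^sup>2 * (c v v - \<mu> * m v v)"
      by (simp add: m.rules c.rules cu u_one c.sym[of v u] m.sym[of v u] algebra_simps power2_eq_square)
  qed
  have orth: "m u s = 0" "c u s = 0" if "s \<in> S" for s
  proof -
    show "m u s = 0" using uW that by (simp add: W_def)
    then show "c u s = 0"
      using S(3)[OF that] eigenD[of s _ u] c.sym[of u s] m.sym[of u s] by auto
  qed
  have "c u v = \<mu> * m u v" for v
  proof -
    define s where "s = (\<Sum>e\<in>S. m v e *\<^sub>R e)"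
    have "m u s = 0" "c u s = 0" by (simp_all add: s_def m.sum_right c.sum_right m.rules c.rules orth)
    moreover have "v - s \<in> W" using m.orthonormal_residual[OF S(1,2)] by (simp add: W_def s_def)
    ultimately show ?thesis using eigen_W[of "v - s"] by (simp add: m.rules c.rules)
  qed
  then have "u \<in> E \<mu>" by (simp add: pencil_eigenspace_def)
  moreover have "\<forall>e\<in>S. m u e = 0" using orth(1) by blast
  ultimately show ?thesis using that u_one mu_le[OF zW] by blast
qed

text \<open>
  A maximal orthonormal set \<open>S\<close> of eigenvectors with eigenvalues up to \<open>\<tau>\<close> is finite, since its
  members have energy at most \<open>\<tau>\<close>. If it did not span some eigenspace, the residual of a projection
  could be normalised and added to it. The part of \<open>S\<close> in each eigenspace is then a basis of that
  eigenspace, so \<open>S\<close> counts the eigenvalues up to \<open>\<tau>\<close> with multiplicity.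
\<close>

lemma complete_orthonormal_eigenvectors:
  obtains S where "finite S" "orthonormal_for m S"
    "\<forall>e\<in>S. \<exists>\<nu>\<le>\<tau>. e \<in> E \<nu>"
    "\<forall>\<nu>\<le>\<tau>. E \<nu> \<subseteq> span (S \<inter> E \<nu>)"
    "finite (spectrum_upto \<tau>)" "multiplicity_upto \<tau> = card S"
proof -
  define \<A> where "\<A> = {S. orthonormal_for m S \<and> (\<forall>e\<in>S. \<exists>\<nu>\<le>\<tau>. e \<in> E \<nu>)}"
  have "\<exists>M\<in>\<A>. \<forall>X\<in>\<A>. M \<subseteq> X \<longrightarrow> X = M"
  proof (rule subset_Zorn')
    fix \<C> assume chain: "subset.chain \<A> \<C>"
    have "orthonormal_for m (\<Union>\<C>)"
    proof -
      have "m e f = 0" if ef: "e \<in> X" "X \<in> \<C>" "f \<in> Y" "Y \<in> \<C>" "e \<noteq> f" for e f X Y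
      proof -
        have "X \<subseteq> Y \<or> Y \<subseteq> X" using chain ef by (auto simp: subset_chain_def)
        then obtain Z where "Z \<in> \<C>" "e \<in> Z" "f \<in> Z" using ef by blast
        moreover have "Z \<in> \<A>" using chain \<open>Z \<in> \<C>\<close> by (auto simp: subset_chain_def)
        ultimately show ?thesis using \<open>e \<noteq> f\<close> by (auto simp: \<A>_def orthonormal_for_def)
      qed
      moreover have "m e e = 1" if "e \<in> X" "X \<in> \<C>" for e X
        using that chain by (auto simp: subset_chain_def \<A>_def orthonormal_for_def)
      ultimately show ?thesis unfolding orthonormal_for_def by blast
    qed
    moreover have "\<forall>e\<in>\<Union>\<C>. \<exists>\<nu>\<le>\<tau>. e \<in> E \<nu>"
      using chain unfolding subset_chain_def \<A>_def by blast
    ultimately show "\<Union>\<C> \<in> \<A>" by (simp add: \<A>_def)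
  qed
  then obtain S where S: "S \<in> \<A>" and max: "\<And>X. X \<in> \<A> \<Longrightarrow> S \<subseteq> X \<Longrightarrow> X = S" by blast
  have on: "orthonormal_for m S" and eig: "\<And>e. e \<in> S \<Longrightarrow> \<exists>\<nu>\<le>\<tau>. e \<in> E \<nu>"
    using S by (auto simp: \<A>_def)
  have one: "m e e = 1" if "e \<in> S" for e using on that by (simp add: orthonormal_for_def)
  have "c e e \<le> \<tau>" if "e \<in> S" for e using eig[OF that] eigenD[of e] one[OF that] by auto
  then have fin: "finite S" using orthonormal_bounded_energy_finite[OF on] by blast
  have spans: "E \<nu> \<subseteq> span (S \<inter> E \<nu>)" if \<nu>: "\<nu> \<le> \<tau>" for \<nu>
  proof
    fix v assume v: "v \<in> E \<nu>"
    let ?S = "S \<inter> E \<nu>"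
    define p where "p = (\<Sum>e\<in>?S. m v e *\<^sub>R e)"
    have p_span: "p \<in> span ?S" unfolding p_def by (intro span_sum span_scale span_base)
    have "span ?S \<subseteq> E \<nu>" using span_minimal[OF _ subspace_E] by blast
    then have res: "v - p \<in> E \<nu>" using v p_span subspace_E subspace_diff by blast
    \<comment> \<open>The projection only uses the part of \<open>S\<close> in the eigenspace of \<open>\<nu>\<close>; the other members are
      orthogonal to that eigenspace anyway.\<close>
    have orth: "m (v - p) e = 0" if "e \<in> S" for e
    proof (cases "e \<in> E \<nu>")
      case True
      have "orthonormal_for m ?S" using on by (auto simp: orthonormal_for_def)
      with True show ?thesis unfolding p_def using fin \<open>e \<in> S\<close>
        by (intro m.orthonormal_residual) auto
    next
      case False
      then show ?thesis using eig[OF \<open>e \<in> S\<close>] eigen_orthogonal[OF res] by blast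
    qed
    have "v - p = 0"
    proof (rule ccontr)
      assume "v - p \<noteq> 0"
      then obtain k where k: "k \<noteq> 0" "m (k *\<^sub>R (v - p)) (k *\<^sub>R (v - p)) = 1"
        using normalise by blast
      let ?e = "k *\<^sub>R (v - p)"
      have e_orth: "m ?e e = 0" "m e ?e = 0" if "e \<in> S" for e
        using orth[OF that] m.sym[of e ?e] by (simp_all add: m.rules(5))
      have "?e \<in> E \<nu>" using res subspace_E subspace_scale by blast
      then have "insert ?e S \<in> \<A>"
        using on eig k(2) e_orth \<nu> by (auto simp: \<A>_def orthonormal_for_def)
      then have "?e \<in> S" using max by blast
      then show False using e_orth k(2) by simp
    qed
    then show "v \<in> span ?S" using p_span by simp
  qed
  have spectrum: "spectrum_upto \<tau> \<subseteq> (\<lambda>e. c e e) ` S"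
  proof
    fix \<nu> assume "\<nu> \<in> spectrum_upto \<tau>"
    then obtain u where u: "u \<noteq> 0" "u \<in> E \<nu>" "\<nu> \<le> \<tau>" by (auto simp: spectrum_upto_def)
    then have "S \<inter> E \<nu> \<noteq> {}" using spans[of \<nu>] by force
    then obtain e where "e \<in> S" "e \<in> E \<nu>" by blast
    then have "\<nu> = c e e" using eigenD[of e \<nu> e] one by simp
    then show "\<nu> \<in> (\<lambda>e. c e e) ` S" using \<open>e \<in> S\<close> by blast
  qed
  then have finspec: "finite (spectrum_upto \<tau>)" using fin finite_subset by blast
  have nz: "e \<noteq> 0" if "e \<in> S" for e using one[OF that] by (auto simp: m.rules)
  have "S = (\<Union>\<nu>\<in>spectrum_upto \<tau>. S \<inter> E \<nu>)"
    using eig nz by (fastforce simp: spectrum_upto_def)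
  moreover have "S \<inter> E \<mu> \<inter> (S \<inter> E \<nu>) = {}" if "\<mu> \<noteq> \<nu>" for \<mu> \<nu>
    using eigen_orthogonal[OF _ _ that] one by fastforce
  ultimately have "card S = (\<Sum>\<nu>\<in>spectrum_upto \<tau>. card (S \<inter> E \<nu>))"
    using card_UN_disjoint[OF finspec, of "\<lambda>\<nu>. S \<inter> E \<nu>"] fin by simp
  also have "\<dots> = multiplicity_upto \<tau>"
    unfolding multiplicity_upto_def
  proof (intro sum.cong refl)
    fix \<nu> assume "\<nu> \<in> spectrum_upto \<tau>"
    then have "E \<nu> \<subseteq> span (S \<inter> E \<nu>)" using spans by (simp add: spectrum_upto_def)
    moreover have "independent (S \<inter> E \<nu>)"
      using m.orthonormal_independent[OF fin on] independent_mono by blast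
    ultimately show "card (S \<inter> E \<nu>) = dim (E \<nu>)" using dim_unique[of "S \<inter> E \<nu>"] by auto
  qed
  finally have card: "multiplicity_upto \<tau> = card S" ..
  show ?thesis
  proof (rule that[OF fin on _ _ finspec card])
    show "\<forall>e\<in>S. \<exists>\<nu>\<le>\<tau>. e \<in> E \<nu>" using eig by blast
    show "\<forall>\<nu>\<le>\<tau>. E \<nu> \<subseteq> span (S \<inter> E \<nu>)" using spans by blast
  qed
qed

text \<open>
  The inequality of the min-max principle that compares eigenvalues with arbitrary subspaces. If
  \<open>P\<close> had more elements than there are eigenvalues up to \<open>\<tau>\<close>, then some nonzero vector of \<open>span P\<close>
  would be orthogonal to all eigenvectors for these eigenvalues. Minimising the Rayleigh
  quotient over their complement would give one more eigenvector with an eigenvalue at most \<open>\<tau>\<close>.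
\<close>

lemma card_le_multiplicity_upto:
  assumes P: "finite P" "independent P"
    and le: "\<And>z. z \<in> span P \<Longrightarrow> c z z \<le> \<tau> * m z z"
  shows "card P \<le> multiplicity_upto \<tau>"
proof (rule ccontr)
  assume neg: "\<not> ?thesis"
  obtain S where S: "finite S" "orthonormal_for m S" "\<forall>e\<in>S. \<exists>\<nu>\<le>\<tau>. e \<in> E \<nu>"
    "\<forall>\<nu>\<le>\<tau>. E \<nu> \<subseteq> span (S \<inter> E \<nu>)"
    "finite (spectrum_upto \<tau>)" "multiplicity_upto \<tau> = card S"
    using complete_orthonormal_eigenvectors[of \<tau>] .
  have eig: "\<exists>\<nu>. e \<in> E \<nu>" if "e \<in> S" for e using S(3) that by blast
  obtain z where z: "z \<in> span P" "z \<noteq> 0" "\<And>e. e \<in> S \<Longrightarrow> m z e = 0"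
    using m.exists_orthogonal_in_larger_span[OF S(1,2) P] neg S(6) by auto
  obtain u \<mu> where u: "u \<in> E \<mu>" "m u u = 1" "\<forall>e\<in>S. m u e = 0" "\<mu> * m z z \<le> c z z"
    using constrained_minimiser_eigenvector[OF S(1,2) eig z(2,3)] .
  have "\<mu> * m z z \<le> \<tau> * m z z" using u(4) le[OF z(1)] by linarith
  then have "\<mu> \<le> \<tau>" using m_pos[OF z(2)] by simp
  then have "u \<in> span S" using S(4) u(1) span_mono[of "S \<inter> E \<mu>" S] by blast
  then have "m u u = 0" by (rule m.orthogonal_span) (use u(3) in blast)
  then show False using u(2) by simp
qed

text \<open>
  The other half of the min-max principle: the eigenvectors themselves span a subspace on which
  the bound \<open>\<tau>\<close> for the Rayleigh quotient holds.
\<close>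

lemma energy_le_on_span_eigenvectors:
  assumes S: "finite S" "orthonormal_for m S" "\<And>e. e \<in> S \<Longrightarrow> \<exists>\<nu>\<le>\<tau>. e \<in> E \<nu>"
    and z: "z \<in> span S"
  shows "c z z \<le> \<tau> * m z z"
proof -
  obtain x where x: "z = (\<Sum>e\<in>S. x e *\<^sub>R e)" using z span_finite[OF S(1)] by auto
  have c_le: "x e * c e z \<le> \<tau> * (x e)\<^sup>2" if e: "e \<in> S" for e
  proof -
    obtain \<nu> where \<nu>: "\<nu> \<le> \<tau>" "e \<in> E \<nu>" using S(3)[OF e] by blast
    have "m z e = x e" unfolding x by (rule m.orthonormal_sum_coefficient[OF S(1,2) e])
    then have "m e z = x e" using m.sym[of e z] by simp
    then have "x e * c e z = \<nu> * (x e)\<^sup>2" using eigenD[OF \<nu>(2)] by (simp add: power2_eq_square)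
    then show ?thesis using \<nu>(1) by (simp add: mult_right_mono)
  qed
  have "c z z = (\<Sum>e\<in>S. x e * c e z)"
    using c.sum_left[of "\<lambda>e. x e *\<^sub>R e" S z] by (simp add: x[symmetric] c.rules)
  also have "\<dots> \<le> (\<Sum>e\<in>S. \<tau> * (x e)\<^sup>2)" by (intro sum_mono c_le)
  also have "\<dots> = \<tau> * m z z"
    using m.orthonormal_sum_square[OF S(1,2), of x] by (simp add: x[symmetric] sum_distrib_left)
  finally show ?thesis .
qed

text \<open>
  As long as the eigenvectors found so far do not span the space, minimising over their
  orthogonal complement produces a further one. If they do span it, the space is
  finite-dimensional and the assumption on \<open>n\<close> applies.
\<close>

lemma exists_multiplicity_upto_ge:
  assumes "(\<exists>B :: 'a set. finite B \<and> span B = UNIV) \<Longrightarrow> n \<le> dim (UNIV :: 'a set)"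
  shows "\<exists>\<tau>. n \<le> multiplicity_upto \<tau>"
proof -
  have "k \<le> n \<Longrightarrow> \<exists>\<tau>. k \<le> multiplicity_upto \<tau>" for k
  proof (induction k)
    case (Suc k)
    then obtain \<tau> where \<tau>: "k \<le> multiplicity_upto \<tau>" by auto
    obtain S where S: "finite S" "orthonormal_for m S" "\<forall>e\<in>S. \<exists>\<nu>\<le>\<tau>. e \<in> E \<nu>"
      "\<forall>\<nu>\<le>\<tau>. E \<nu> \<subseteq> span (S \<inter> E \<nu>)"
      "finite (spectrum_upto \<tau>)" "multiplicity_upto \<tau> = card S"
      using complete_orthonormal_eigenvectors[of \<tau>] .
    have eig: "\<exists>\<nu>. e \<in> E \<nu>" if "e \<in> S" for e using S(3) that by blast
    show ?case
    proof (cases "span S = UNIV")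
      case True
      then have "n \<le> dim (UNIV :: 'a set)" using assms S(1) by blast
      also have "\<dots> = card S"
        using dim_span_eq_card_independent[OF m.orthonormal_independent[OF S(1,2)]] True by simp
      finally have "Suc k \<le> card S" using Suc.prems by simp
      then show ?thesis using S(6) by metis
    next
      case False
      then obtain v where v: "v \<notin> span S" by blast
      define z where "z = v - (\<Sum>e\<in>S. m v e *\<^sub>R e)"
      have "z \<noteq> 0"
      proof
        assume "z = 0"
        then have "v = (\<Sum>e\<in>S. m v e *\<^sub>R e)" by (simp add: z_def)
        also have "\<dots> \<in> span S" by (intro span_sum span_scale span_base)
        finally show False using v by simp
      qed
      have z_orth: "m z e = 0" if "e \<in> S" for e
        unfolding z_def by (rule m.orthonormal_residual[OF S(1,2) that])
      obtain u \<mu> where u: "u \<in> E \<mu>" "m u u = 1" "\<forall>e\<in>S. m u e = 0"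
        "\<mu> * m z z \<le> c z z"
        using constrained_minimiser_eigenvector[OF S(1,2) eig \<open>z \<noteq> 0\<close> z_orth] .
      let ?T = "insert u S" and ?\<tau> = "max \<mu> \<tau>"
      have uS: "u \<notin> S" using u(2,3) by force
      have u_orth: "m e u = 0" if "e \<in> S" for e using u(3) that m.sym[of e u] by simp
      have T: "\<exists>\<nu>\<le>?\<tau>. e \<in> E \<nu>" if "e \<in> ?T" for e
        using S(3) u(1) that by (metis insertE max.cobounded1 max.coboundedI2)
      have T': "finite ?T" "orthonormal_for m ?T"
        using S(1,2) u(2,3) u_orth by (simp_all add: orthonormal_for_def)
      have "card ?T \<le> multiplicity_upto ?\<tau>"
        using T'(1) m.orthonormal_independent[OF T'] energy_le_on_span_eigenvectors[OF T' T]
        by (rule card_le_multiplicity_upto)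
      then have "Suc k \<le> multiplicity_upto ?\<tau>" using \<tau> S(1,6) uS by simp
      then show ?thesis by blast
    qed
  qed simp
  then show ?thesis by blast
qed

definition nth_eigenvalue :: "nat \<Rightarrow> real" where
  "nth_eigenvalue n = (LEAST \<mu>. (\<exists>u. u \<noteq> 0 \<and> u \<in> E \<mu>) \<and> n \<le> multiplicity_upto \<mu>)"

text \<open>
  The least element in the definition of the \<open>n\<close>-th eigenvalue exists, because one candidate is the
  largest eigenvalue up to \<open>\<tau>\<close> and only finitely many eigenvalues lie below it.
\<close>

lemma nth_eigenvalue_characterisation:
  assumes "n \<ge> 1" "n \<le> multiplicity_upto \<tau>"
  shows "n \<le> multiplicity_upto (nth_eigenvalue n)" "nth_eigenvalue n \<le> \<tau>"
proof -
  let ?Q = "\<lambda>\<mu>. (\<exists>u. u \<noteq> 0 \<and> u \<in> E \<mu>) \<and> n \<le> multiplicity_upto \<mu>"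
  have fin: "finite (spectrum_upto \<tau>)" by (rule complete_orthonormal_eigenvectors[of \<tau>])
  have ne: "spectrum_upto \<tau> \<noteq> {}" using assms by (auto simp: multiplicity_upto_def)
  define \<mu> where "\<mu> = Max (spectrum_upto \<tau>)"
  have \<mu>: "\<mu> \<in> spectrum_upto \<tau>" unfolding \<mu>_def using fin ne by (rule Max_in)
  have "spectrum_upto \<mu> = spectrum_upto \<tau>"
    using \<mu> Max_ge[OF fin] unfolding \<mu>_def[symmetric] by (auto simp: spectrum_upto_def)
  then have Q\<mu>: "?Q \<mu>" using assms(2) \<mu> by (auto simp: multiplicity_upto_def spectrum_upto_def)
  let ?F = "{\<nu> \<in> spectrum_upto \<tau>. ?Q \<nu>}"
  have F: "finite ?F" "?F \<noteq> {}" using fin \<mu> Q\<mu> by auto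
  have least: "nth_eigenvalue n = Min ?F"
    unfolding nth_eigenvalue_def
  proof (rule Least_equality)
    show "?Q (Min ?F)" using Min_in[OF F] by blast
    fix y assume y: "?Q y"
    show "Min ?F \<le> y"
    proof (cases "y \<le> \<tau>")
      case True
      then have "y \<in> ?F" using y by (auto simp: spectrum_upto_def)
      then show ?thesis by (rule Min_le[OF F(1)])
    next
      case False
      have "Min ?F \<le> \<tau>" using Min_in[OF F] by (auto simp: spectrum_upto_def)
      then show ?thesis using False by simp
    qed
  qed
  then show "n \<le> multiplicity_upto (nth_eigenvalue n)" "nth_eigenvalue n \<le> \<tau>"
    using Min_in[OF F] by (auto simp: spectrum_upto_def)
qed

end

section \<open>Comparison of eigenvalues and Lipschitz continuity\<close>

text \<open>
  The \<open>n\<close>-th eigenvalue is monotone in the form: the span of the first \<open>n\<close> or more eigenvectors of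
  \<open>c\<close> is a test space for \<open>c'\<close>.
\<close>

lemma nth_eigenvalue_comparison:
  fixes c c' m :: "'a::{real_inner, complete_space} \<Rightarrow> 'a \<Rightarrow> real"
  assumes "form_pencil c m \<kappa> K" "form_pencil c' m \<kappa>' K'"
    and n: "n \<ge> 1" "(\<exists>B :: 'a set. finite B \<and> span B = UNIV) \<Longrightarrow> n \<le> dim (UNIV :: 'a set)"
    and le: "\<And>z. c' z z \<le> p * c z z + q * m z z" and "p \<ge> 0"
  shows "form_pencil.nth_eigenvalue c' m n \<le> p * form_pencil.nth_eigenvalue c m n + q"
proof -
  interpret P: form_pencil c m \<kappa> K by fact
  interpret P': form_pencil c' m \<kappa>' K' by fact
  let ?\<mu> = "P.nth_eigenvalue n"
  obtain \<tau> where "n \<le> P.multiplicity_upto \<tau>" using P.exists_multiplicity_upto_ge[OF n(2)] by blast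
  then have mult: "n \<le> P.multiplicity_upto ?\<mu>"
    using P.nth_eigenvalue_characterisation(1)[OF n(1)] by blast
  obtain S where S: "finite S" "orthonormal_for m S" "\<forall>e\<in>S. \<exists>\<nu>\<le>?\<mu>. e \<in> P.E \<nu>"
    "\<forall>\<nu>\<le>?\<mu>. P.E \<nu> \<subseteq> span (S \<inter> P.E \<nu>)"
    "finite (P.spectrum_upto ?\<mu>)" "P.multiplicity_upto ?\<mu> = card S"
    using P.complete_orthonormal_eigenvectors[of ?\<mu>] .
  have "c' z z \<le> (p * ?\<mu> + q) * m z z" if "z \<in> span S" for z
  proof -
    have "c z z \<le> ?\<mu> * m z z"
      using P.energy_le_on_span_eigenvectors[OF S(1,2) _ that] S(3) by blast
    then have "p * c z z \<le> p * (?\<mu> * m z z)" using \<open>p \<ge> 0\<close> by (rule mult_left_mono)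
    then show ?thesis using le[of z] by (simp add: algebra_simps)
  qed
  then have "card S \<le> P'.multiplicity_upto (p * ?\<mu> + q)"
    using P'.card_le_multiplicity_upto[OF S(1) P.m.orthonormal_independent[OF S(1,2)]] by blast
  then have "n \<le> P'.multiplicity_upto (p * ?\<mu> + q)" using mult S(6) by simp
  then show ?thesis by (rule P'.nth_eigenvalue_characterisation(2)[OF n(1)])
qed

text \<open>
  If no constant \<open>C\<close> worked, there would be vectors \<open>w\<close> with \<open>a w w = 1\<close>, with \<open>\<bar>b w w\<bar>\<close> bounded below
  by \<open>\<epsilon>\<close> and with \<open>m w w\<close> tending to 0 relative to \<open>\<bar>b w w\<bar>\<close>. Their weak limit \<open>u\<close> has \<open>m u u = 0\<close>, hence
  \<open>u = 0\<close>, while weak continuity of \<open>b\<close> gives \<open>\<bar>b u u\<bar> \<ge> \<epsilon>\<close>.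
\<close>

lemma relative_form_bound:
  fixes a b m :: "'a::{real_inner, complete_space} \<Rightarrow> 'a \<Rightarrow> real"
  assumes sep: "separable_space (euclidean :: 'a topology)"
    and forms: "symmetric_bilinear_form a" "symmetric_bilinear_form b" "symmetric_bilinear_form m"
    and a: "continuous_coercive a" and b: "weakly_continuous_form b"
    and m: "weakly_continuous_form m" "\<And>u. u \<noteq> 0 \<Longrightarrow> m u u > 0"
    and "\<epsilon> > 0"
  shows "\<exists>C. \<forall>u. \<bar>b u u\<bar> \<le> \<epsilon> * a u u + C * m u u"
proof (rule ccontr)
  interpret a: symmetric_form a by standard (rule forms)
  interpret b: symmetric_form b by standard (rule forms)
  interpret m: symmetric_form m by standard (rule forms)
  obtain \<kappa> where \<kappa>: "\<kappa> > 0" "\<And>u. \<kappa> * (norm u)\<^sup>2 \<le> a u u"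
    using a unfolding continuous_coercive_def by blast
  have m_nonneg: "m u u \<ge> 0" for u using m(2)[of u] by (cases "u = 0") (simp_all add: m.rules)
  assume neg: "\<not> ?thesis"
  have "\<exists>w. a w w = 1 \<and> \<epsilon> + real (Suc j) * m w w < \<bar>b w w\<bar>" for j
  proof -
    have "\<not> (\<forall>u. \<bar>b u u\<bar> \<le> \<epsilon> * a u u + real (Suc j) * m u u)"
      using neg by blast
    then obtain u where u: "\<epsilon> * a u u + real (Suc j) * m u u < \<bar>b u u\<bar>" by (auto simp: not_le)
    have "u \<noteq> 0" using u by (auto simp: a.rules b.rules m.rules)
    then have "0 < \<kappa> * (norm u)\<^sup>2" using \<kappa>(1) by simp
    then have pos: "a u u > 0" using \<kappa>(2)[of u] by linarith
    define w where "w = (1 / sqrt (a u u)) *\<^sub>R u"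
    have w: "a w w = 1" "b w w = b u u / a u u" "m w w = m u u / a u u"
      using pos by (simp_all add: w_def a.rules b.rules m.rules)
    have "\<epsilon> + real (Suc j) * m w w = (\<epsilon> * a u u + real (Suc j) * m u u) / a u u"
      unfolding w using pos by (simp add: add_divide_distrib)
    also have "\<dots> < \<bar>b u u\<bar> / a u u" using u pos by (rule divide_strict_right_mono)
    also have "\<dots> = \<bar>b w w\<bar>" unfolding w using pos by simp
    finally show ?thesis using w(1) by blast
  qed
  then obtain w where w: "\<And>j. a (w j) (w j) = 1"
    "\<And>j. \<epsilon> + real (Suc j) * m (w j) (w j) < \<bar>b (w j) (w j)\<bar>" by metis
  have bound: "norm (w j) \<le> sqrt (1 / \<kappa>)" for j
    using \<kappa>(2)[of "w j"] \<kappa>(1) w(1) by (intro real_le_rsqrt) (simp add: field_simps)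
  obtain u r where r: "strict_mono (r :: nat \<Rightarrow> nat)" and u: "weakly_convergent_to (w \<circ> r) u"
    using bounded_imp_weakly_convergent_subsequence[OF sep bound] .
  let ?w = "\<lambda>j. w (r j)"
  have lim_b: "(\<lambda>j. \<bar>b (?w j) (?w j)\<bar>) \<longlonglongrightarrow> \<bar>b u u\<bar>"
    using b u unfolding weakly_continuous_form_def by (intro tendsto_rabs) (simp add: o_def)
  have lim_m: "(\<lambda>j. m (?w j) (?w j)) \<longlonglongrightarrow> m u u"
    using m(1) u unfolding weakly_continuous_form_def by (simp add: o_def)
  have b_large: "\<epsilon> \<le> \<bar>b (?w j) (?w j)\<bar>" for j
  proof -
    have "0 \<le> real (Suc (r j)) * m (?w j) (?w j)" using m_nonneg by simp
    then show ?thesis using w(2)[of "r j"] by linarith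
  qed
  have m_small: "m (?w j) (?w j) \<le> \<bar>b (?w j) (?w j)\<bar> * (1 / real (Suc (r j)))" for j
  proof -
    have "real (Suc (r j)) * m (?w j) (?w j) \<le> \<bar>b (?w j) (?w j)\<bar>"
      using w(2)[of "r j"] \<open>\<epsilon> > 0\<close> by linarith
    then show ?thesis by (simp add: field_simps del: of_nat_Suc)
  qed
  have "(\<lambda>j. \<bar>b (?w j) (?w j)\<bar> * (1 / real (Suc (r j)))) \<longlonglongrightarrow> \<bar>b u u\<bar> * 0"
    using LIMSEQ_subseq_LIMSEQ[OF LIMSEQ_Suc[OF lim_1_over_n] r]
    by (intro tendsto_mult lim_b) (simp add: o_def)
  with lim_m have "m u u \<le> \<bar>b u u\<bar> * 0" by (rule LIMSEQ_le) (use m_small in blast)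
  then have "u = 0" using m(2)[of u] by force
  moreover have "\<epsilon> \<le> \<bar>b u u\<bar>" using lim_b by (rule LIMSEQ_le_const) (use b_large in blast)
  ultimately show False using \<open>\<epsilon> > 0\<close> by (simp add: b.rules)
qed

text \<open>
  Only the quadratic form is assumed to be bounded. Polarisation gives a bound for \<open>a u v\<close> with
  \<open>u\<close> in the unit ball, and homogeneity in \<open>u\<close> does the rest.
\<close>

lemma bounded_linear_continuous_coercive:
  assumes "symmetric_bilinear_form a" "continuous_coercive a"
  shows "bounded_linear (\<lambda>u. a u v)"
proof -
  interpret a: symmetric_form a by standard (rule assms)
  obtain \<kappa>1 \<kappa>2 where \<kappa>: "0 < \<kappa>1" "\<kappa>1 \<le> \<kappa>2"
    and lower: "\<And>u. \<kappa>1 * (norm u)\<^sup>2 \<le> a u u" and upper: "\<And>u. a u u \<le> \<kappa>2 * (norm u)\<^sup>2"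
    using assms(2) unfolding continuous_coercive_def by blast
  have nonneg: "0 \<le> a u u" for u
  proof -
    have "0 \<le> \<kappa>1 * (norm u)\<^sup>2" using \<kappa> by simp
    then show ?thesis using lower[of u] by linarith
  qed
  have unit: "\<bar>a u v\<bar> \<le> \<kappa>2 * (1 + norm v)\<^sup>2" if u: "norm u \<le> 1" for u
  proof -
    have upper': "a w w \<le> \<kappa>2 * (1 + norm v)\<^sup>2" if "norm w \<le> 1 + norm v" for w
    proof -
      have "\<kappa>2 * (norm w)\<^sup>2 \<le> \<kappa>2 * (1 + norm v)\<^sup>2"
        using that \<kappa> by (intro mult_left_mono power_mono) auto
      then show ?thesis using upper[of w] by linarith
    qed
    have "norm (u + v) \<le> 1 + norm v" "norm (u - v) \<le> 1 + norm v"
      using u norm_triangle_ineq[of u v] norm_triangle_ineq4[of u v] by linarith+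
    then have "a (u + v) (u + v) \<le> \<kappa>2 * (1 + norm v)\<^sup>2" "a (u - v) (u - v) \<le> \<kappa>2 * (1 + norm v)\<^sup>2"
      by (auto intro: upper')
    moreover have "a (u + v) (u + v) = 4 * a u v + a (u - v) (u - v)"
      using a.sym[of v u] by (simp add: a.rules)
    ultimately show ?thesis using nonneg[of "u + v"] nonneg[of "u - v"] by linarith
  qed
  show ?thesis
  proof (rule bounded_linear_intro)
    show "a (x + y) v = a x v + a y v" "a (k *\<^sub>R x) v = k *\<^sub>R a x v" for x y k
      by (simp_all add: a.rules)
    fix x
    have "a x v = norm x * a (sgn x) v"
      by (cases "x = 0") (simp_all add: a.rules sgn_div_norm)
    then have "\<bar>a x v\<bar> = norm x * \<bar>a (sgn x) v\<bar>" by (simp add: abs_mult)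
    also have "\<dots> \<le> norm x * (\<kappa>2 * (1 + norm v)\<^sup>2)"
      by (intro mult_left_mono unit) (simp_all add: norm_sgn)
    finally show "norm (a x v) \<le> norm x * (\<kappa>2 * (1 + norm v)\<^sup>2)" by simp
  qed
qed

theorem theorem6p1:
  fixes a b m :: "'a::{real_inner, complete_space} \<Rightarrow> 'a \<Rightarrow> real" and n :: nat
  assumes "separable_space (euclidean :: 'a topology)"
    and "symmetric_bilinear_form a" and "symmetric_bilinear_form b" and "symmetric_bilinear_form m"
    and "continuous_coercive a"
    and "weakly_continuous_form b"
    and "weakly_continuous_form m" and "\<And>u. u \<noteq> 0 \<Longrightarrow> m u u > 0"
    and "n \<ge> 1"
    and "(\<exists>B :: 'a set. finite B \<and> span B = UNIV) \<Longrightarrow> n \<le> dim (UNIV :: 'a set)"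
  shows "locally_lipschitz (eigencurve a b m n)"
  unfolding locally_lipschitz_def
proof (intro allI)
  fix \<alpha> \<beta> :: real
  interpret a: symmetric_form a by standard (rule assms)
  interpret b: symmetric_form b by standard (rule assms)
  define T where "T = max \<bar>\<alpha>\<bar> \<bar>\<beta>\<bar>"
  define \<epsilon> where "\<epsilon> = 1 / (2 * (T + 1))"
  have T: "\<bar>t\<bar> \<le> T" if "t \<in> {\<alpha>..\<beta>}" for t using that by (auto simp: T_def)
  have T0: "T \<ge> 0" by (simp add: T_def)
  then have \<epsilon>: "\<epsilon> > 0" "T * \<epsilon> \<le> 1 / 2" by (simp_all add: \<epsilon>_def field_simps)
  obtain C where C: "\<And>u. \<bar>b u u\<bar> \<le> \<epsilon> * a u u + C * m u u"
    using relative_form_bound[OF assms(1-8) \<epsilon>(1)] by blast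
  obtain \<kappa> where \<kappa>: "\<kappa> > 0" "\<And>u. \<kappa> * (norm u)\<^sup>2 \<le> a u u"
    using assms(5) unfolding continuous_coercive_def by blast
  have a_nonneg: "0 \<le> a u u" for u
  proof -
    have "0 \<le> \<kappa> * (norm u)\<^sup>2" using \<kappa> by simp
    then show ?thesis using \<kappa>(2)[of u] by linarith
  qed
  define c where "c t u v = a u v - t * b u v" for t u v
  \<comment> \<open>Absorption: by the choice of \<open>\<epsilon>\<close> at most half of \<open>a\<close> is lost to \<open>t b\<close>, uniformly in \<open>t\<close>.\<close>
  have a_le: "a u u \<le> 2 * c t u u + 2 * (T * C) * m u u" if t: "t \<in> {\<alpha>..\<beta>}" for t u
  proof -
    have "t * b u u \<le> \<bar>t\<bar> * \<bar>b u u\<bar>" by (simp add: abs_mult[symmetric])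
    also have "\<dots> \<le> T * (\<epsilon> * a u u + C * m u u)"
      using T[OF t] T0 C[of u] by (intro mult_mono) auto
    also have "\<dots> = (T * \<epsilon>) * a u u + T * C * m u u" by (simp add: algebra_simps)
    also have "\<dots> \<le> (1 / 2) * a u u + T * C * m u u"
      using \<epsilon>(2) a_nonneg[of u] by (intro add_right_mono mult_right_mono)
    finally show ?thesis by (simp add: c_def)
  qed
  have pencil: "form_pencil (c t) m (\<kappa> / 2) (T * C)" if t: "t \<in> {\<alpha>..\<beta>}" for t
  proof
    show "symmetric_bilinear_form (c t)"
      using a.bil b.bil a.sym b.sym
      unfolding symmetric_bilinear_form_def bilinear_def linear_iff c_def
      by (simp add: algebra_simps)
    show "symmetric_bilinear_form m" "separable_space (euclidean :: 'a topology)"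
      "weakly_continuous_form m" "u \<noteq> 0 \<Longrightarrow> m u u > 0" for u by fact+
    show "\<kappa> / 2 > 0" using \<kappa>(1) by simp
    show "\<kappa> / 2 * (norm u)\<^sup>2 \<le> c t u u + T * C * m u u" for u
      using \<kappa>(2)[of u] a_le[OF t, of u] by simp
    fix x :: "nat \<Rightarrow> 'a" and u v assume x: "weakly_convergent_to x u"
    have "(\<lambda>j. a (x j) v) \<longlonglongrightarrow> a u v"
      using x[unfolded weakly_convergent_to_def, rule_format,
          OF bounded_linear_continuous_coercive[OF assms(2,5), of v]] .
    moreover have "(\<lambda>j. b (x j) v) \<longlonglongrightarrow> b u v"
      using assms(6) x weakly_convergent_const[of v] unfolding weakly_continuous_form_def by blast
    ultimately show "(\<lambda>j. c t (x j) v) \<longlonglongrightarrow> c t u v"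
      unfolding c_def by (intro tendsto_diff tendsto_mult tendsto_const)
  qed
  define \<mu> where "\<mu> = eigencurve a b m n"
  have \<mu>_eq: "\<mu> t = form_pencil.nth_eigenvalue (c t) m n" if t: "t \<in> {\<alpha>..\<beta>}" for t
  proof -
    interpret P: form_pencil "c t" m "\<kappa> / 2" "T * C" by (rule pencil[OF t])
    have "eigenspace a b m t = P.E"
      by (intro ext) (simp add: eigenspace_def pencil_eigenspace_def c_def)
    then show ?thesis
      by (simp add: \<mu>_def eigencurve_def eigenvalue_def P.nth_eigenvalue_def
          P.multiplicity_upto_def P.spectrum_upto_def)
  qed
  \<comment> \<open>Inserting the bound for \<open>a\<close> into the relative bound for \<open>b\<close> gives these constants.\<close>
  define A where "A = 2 * \<epsilon>"
  define B where "B = \<epsilon> * (2 * (T * C)) + C"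
  have A: "A \<ge> 0" using \<epsilon>(1) by (simp add: A_def)
  have b_le: "\<bar>b u u\<bar> \<le> A * c t u u + B * m u u" if t: "t \<in> {\<alpha>..\<beta>}" for t u
  proof -
    have "\<epsilon> * a u u \<le> \<epsilon> * (2 * c t u u + 2 * (T * C) * m u u)"
      using a_le[OF t] \<epsilon>(1) by (intro mult_left_mono) auto
    then show ?thesis using C[of u] by (simp add: A_def B_def algebra_simps)
  qed
  \<comment> \<open>A Lipschitz estimate whose constant still grows with the eigenvalue. Starting it at the left
    end point bounds the eigencurve on the interval, which makes the constant uniform.\<close>
  have step: "\<mu> s - \<mu> t \<le> \<bar>s - t\<bar> * (A * \<mu> t + B)" if s: "s \<in> {\<alpha>..\<beta>}" and t: "t \<in> {\<alpha>..\<beta>}" for s t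
  proof -
    have "c s z z \<le> (1 + \<bar>s - t\<bar> * A) * c t z z + (\<bar>s - t\<bar> * B) * m z z" for z
    proof -
      have "(t - s) * b z z \<le> \<bar>t - s\<bar> * \<bar>b z z\<bar>" by (simp add: abs_mult[symmetric])
      also have "\<dots> \<le> \<bar>s - t\<bar> * (A * c t z z + B * m z z)"
        using b_le[OF t] by (simp add: abs_minus_commute mult_left_mono)
      finally show ?thesis by (simp add: c_def algebra_simps)
    qed
    then have "\<mu> s \<le> (1 + \<bar>s - t\<bar> * A) * \<mu> t + \<bar>s - t\<bar> * B"
      unfolding \<mu>_eq[OF s] \<mu>_eq[OF t] using A
      by (intro nth_eigenvalue_comparison[OF pencil[OF t] pencil[OF s] assms(9,10)]) auto
    then show ?thesis by (simp add: algebra_simps)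
  qed
  define M where "M = \<mu> \<alpha> + (\<beta> - \<alpha>) * \<bar>A * \<mu> \<alpha> + B\<bar>"
  have \<mu>_le: "\<mu> t \<le> M" if t: "t \<in> {\<alpha>..\<beta>}" for t
  proof -
    have "\<mu> t - \<mu> \<alpha> \<le> \<bar>t - \<alpha>\<bar> * (A * \<mu> \<alpha> + B)" using step[OF t, of \<alpha>] t by simp
    also have "\<dots> \<le> \<bar>t - \<alpha>\<bar> * \<bar>A * \<mu> \<alpha> + B\<bar>" by (intro mult_left_mono) auto
    also have "\<dots> \<le> (\<beta> - \<alpha>) * \<bar>A * \<mu> \<alpha> + B\<bar>" using t by (intro mult_right_mono) auto
    finally show ?thesis by (simp add: M_def)
  qed
  have one_sided: "\<mu> s - \<mu> t \<le> \<bar>A * M + B\<bar> * \<bar>s - t\<bar>" if s: "s \<in> {\<alpha>..\<beta>}" and t: "t \<in> {\<alpha>..\<beta>}" for s t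
  proof -
    have "A * \<mu> t + B \<le> \<bar>A * M + B\<bar>"
      using mult_left_mono[OF \<mu>_le[OF t] A] by linarith
    then have "\<bar>s - t\<bar> * (A * \<mu> t + B) \<le> \<bar>s - t\<bar> * \<bar>A * M + B\<bar>" by (intro mult_left_mono) auto
    then show ?thesis using step[OF s t] by (simp add: mult.commute)
  qed
  have "\<bar>A * M + B\<bar>-lipschitz_on {\<alpha>..\<beta>} \<mu>"
  proof (rule lipschitz_onI)
    fix s t assume "s \<in> {\<alpha>..\<beta>}" "t \<in> {\<alpha>..\<beta>}"
    then show "dist (\<mu> s) (\<mu> t) \<le> \<bar>A * M + B\<bar> * dist s t"
      using one_sided[of s t] one_sided[of t s] by (simp add: dist_real_def abs_le_iff abs_minus_commute)
  qed simp
  then show "\<exists>L. L-lipschitz_on {\<alpha>..\<beta>} (eigencurve a b m n)" unfolding \<mu>_def by blast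
qed

end
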